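(* Let $p>1$. Suppose $f:\mathbb R\to\mathbb R$ satisfies $f\in L^1(\mathbb R)\cap L^2(\mathbb R)$ and $|x|^{p/2}f(x)\in L^2(\mathbb R)$ (equivalently, $\int_{\mathbb R}|x|^{p}|f(x)|^2\,dx<\infty$). For $L>0$ let $$B(L):=\sum_{k=0}^{\infty}\frac1L\left|\int_{\mathbb R\setminus[-L,L]} f(x)\cos\left(\frac{k\pi(x+L)}{2L}\right)dx\right|^2 .$$ Then $f$ is COS-admissible, i.e. $B(L)\to 0$ as $L\to\infty$, and for every $L>0$ $$B(L)\le 2\,\zeta(p)\left(L^{-p}\int_{|x|>L}|x|^{p}|f(x)|^2\,dx+\int_{|x|>L}|f(x)|^2\,dx\right).$$ In particular, for every $L>0$, $$B(L)\le 4\,\zeta(p)\,L^{-p}\int_{|x|>L}|x|^{p}|f(x)|^2\,dx$$ and $$B(L)\le 4\,\zeta(p)\,L^{-p}\int_{\mathbb R}|x|^{p}|f(x)|^2\,dx .$$ Consequently $B(L)=O(L^{-p})$ as $L\to\infty$, and more precisely $$B(L)\le 2\,\zeta(p)\,L^{-p}\int_{\mathbb R}|x|^{p}|f(x)|^2\,dx+o(L^{-p})\quad\text{as } L\to\infty .$$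
   Context: $\zeta(p)=\sum_{j=1}^\infty j^{-p}$ is the Riemann zeta function. A function $f\in L^1(\mathbb R)$ is called COS-admissible if $B(L)\to0$ as $L\to\infty$, where for $L>0$ $$B(L)=\sum_{k=0}^{\infty}\frac1L\left|\int_{\mathbb R\setminus[-L,L]} f(x)\cos\left(\frac{k\pi(x+L)}{2L}\right)dx\right|^2 ,$$ a quantity a priori in $[0,\infty]$. *)

theory Defs
  imports "HOL-Analysis.Analysis" "HOL-Library.Landau_Symbols"
begin

text \<open>
  Elements of \<open>L\<^sup>1\<close> and \<open>L\<^sup>2\<close> are represented by Lebesgue measurable functions rather than
  by classes modulo null sets; membership in \<open>L\<^sup>1\<close> is \<open>integrable lebesgue\<close>.
\<close>

definition square_integrable :: "(real \<Rightarrow> real) \<Rightarrow> bool" where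
  "square_integrable f \<longleftrightarrow>
     f \<in> borel_measurable lebesgue \<and> integrable lebesgue (\<lambda>x. \<bar>f x\<bar>\<^sup>2)"

text \<open>The series \<open>\<Sum>j\<ge>1. j\<^sup>-\<^sup>p\<close>, with the index shifted by one; only meaningful for \<open>p > 1\<close>.\<close>

definition zeta :: "real \<Rightarrow> real" where
  "zeta p = (\<Sum>j. real (Suc j) powr (-p))"

text \<open>The sum is taken in \<open>[0, \<infinity>]\<close>, so no convergence is presupposed.\<close>

definition cos_B :: "(real \<Rightarrow> real) \<Rightarrow> real \<Rightarrow> ennreal" where
  "cos_B f L = (\<Sum>k. ennreal (1 / L *
     \<bar>LINT x:(UNIV - {-L..L})|lebesgue. f x * cos (real k * pi * (x + L) / (2 * L))\<bar>\<^sup>2))"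

definition COS_admissible :: "(real \<Rightarrow> real) \<Rightarrow> bool" where
  "COS_admissible f \<longleftrightarrow> integrable lebesgue f \<and> (cos_B f \<longlongrightarrow> 0) at_top"

lemma square_integrable_weighted_iff:
  fixes f :: "real \<Rightarrow> real" and p :: real
  assumes "f \<in> borel_measurable lebesgue"
  shows "square_integrable (\<lambda>x. \<bar>x\<bar> powr (p / 2) * f x) \<longleftrightarrow>
           (\<integral>\<^sup>+x. ennreal (\<bar>x\<bar> powr p * \<bar>f x\<bar>\<^sup>2) \<partial>lebesgue) < \<infinity>"
proof -
  have id: "(\<lambda>x::real. x) \<in> borel_measurable lebesgue"
    by (rule measurable_completion) simp
  have m: "(\<lambda>x. \<bar>x\<bar> powr (p / 2) * f x) \<in> borel_measurable lebesgue"
    using assms id by measurable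
  have m2: "(\<lambda>x. \<bar>x\<bar> powr p * \<bar>f x\<bar>\<^sup>2) \<in> borel_measurable lebesgue"
    using assms id by measurable
  have eq: "\<bar>\<bar>x\<bar> powr (p / 2) * f x\<bar>\<^sup>2 = \<bar>x\<bar> powr p * \<bar>f x\<bar>\<^sup>2" for x
  proof -
    have "\<bar>x\<bar> powr p = (\<bar>x\<bar> powr (p / 2))\<^sup>2"
      by (simp add: power2_eq_square flip: powr_add)
    then show ?thesis
      by (simp add: power_mult_distrib)
  qed
  show ?thesis
    unfolding square_integrable_def eq using m m2
    by (simp add: integrable_iff_bounded abs_mult)
qed

end

theory Submission imports Defs begin

text \<open>
  Write \<open>a\<^sub>k\<close> for the \<open>k\<close>-th cosine coefficient of the tail of \<open>f\<close> and \<open>T = \<Sum>k<K. a\<^sub>k / L * cos\<^sub>k\<close>, so that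
  the partial sum \<open>S\<close> of \<open>B(L)\<close> equals the integral of \<open>f * T\<close> over the tail. With
  \<open>W x = (\<bar>x\<bar>/L)\<^sup>p + 1\<close>, Young's inequality gives
  \<open>S \<le> \<zeta>(p) * \<integral> f\<^sup>2 * W + \<integral> T\<^sup>2 / W / (4 * \<zeta>(p))\<close>.
  The cosines are orthogonal on every interval \<open>[(2m-1)L, (2m+1)L]\<close>, where \<open>T\<^sup>2\<close> has
  integral at most \<open>2 * S\<close> (the factor 2 is due to the constant mode) and
  \<open>W \<ge> (2\<bar>m\<bar>-1)\<^sup>p + 1\<close>. Since \<open>\<Sum>m\<noteq>0. 1 / ((2\<bar>m\<bar>-1)\<^sup>p + 1) \<le> \<zeta>(p)\<close>, the last integral is at
  most \<open>2 * \<zeta>(p) * S\<close>, whence \<open>S \<le> 2 * \<zeta>(p) * \<integral> f\<^sup>2 * W\<close>.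
\<close>

section \<open>The zeta series and reciprocals over odd integers\<close>

lemma summable_zeta:
  assumes "p > 1"
  shows "summable (\<lambda>j. real (Suc j) powr (-p))"
  using assms summable_real_powr_iff[of "-p"]
  by (subst summable_Suc_iff[of "\<lambda>j. real j powr (-p)"]) simp

lemma zeta_ge_1:
  assumes "p > 1"
  shows "zeta p \<ge> 1"
  using sum_le_suminf[OF summable_zeta[OF assms], of "{0}"] by (simp add: zeta_def)

text \<open>For \<open>j > 0\<close> the summand is at most \<open>(2j)\<^sup>-\<^sup>p + (2j+1)\<^sup>-\<^sup>p\<close>; for \<open>j = 0\<close> it equals \<open>1\<close>.\<close>

lemma odd_reciprocal_sum_le_zeta:
  assumes "p > 1"
  shows "(\<Sum>j<n. 2 / (real (2 * j + 1) powr p + 1)) \<le> zeta p"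
proof -
  \<comment> \<open>Summing to \<open>Suc n\<close> puts the exceptional term \<open>j = 0\<close>
    into the base case, where both sides equal 1. Each further \<open>j\<close> then uses up two
    consecutive terms of the zeta series.\<close>
  have "(\<Sum>j<Suc n. 2 / (real (2 * j + 1) powr p + 1)) \<le> (\<Sum>i<2 * n + 1. real (Suc i) powr (-p))"
  proof (induction n)
    case 0
    then show ?case by simp
  next
    case (Suc n)
    let ?a = "real (2 * n + 3)"
    have "1 / (?a powr p + 1) \<le> 1 / ?a powr p"
      by (intro divide_left_mono mult_pos_pos add_nonneg_pos) auto
    also have "1 / ?a powr p = ?a powr (-p)"
      by (simp add: powr_minus_divide)
    finally have 1: "1 / (?a powr p + 1) \<le> ?a powr (-p)" .
    have 2: "?a powr (-p) \<le> real (2 * n + 2) powr (-p)"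
      using assms by (intro powr_mono2') auto
    have "2 / (?a powr p + 1) \<le> real (2 * n + 2) powr (-p) + ?a powr (-p)"
      using 1 2 by simp
    with Suc show ?case
      by (simp add: algebra_simps eval_nat_numeral)
  qed
  also have "\<dots> \<le> zeta p"
    unfolding zeta_def by (intro sum_le_suminf summable_zeta assms) auto
  finally have "(\<Sum>j<Suc n. 2 / (real (2 * j + 1) powr p + 1)) \<le> zeta p" .
  moreover have "(\<Sum>j<n. 2 / (real (2 * j + 1) powr p + 1)) \<le> (\<Sum>j<Suc n. 2 / (real (2 * j + 1) powr p + 1))"
    by simp
  ultimately show ?thesis by linarith
qed

section \<open>Orthogonality of the cosines on cells of length 2L\<close>

text \<open>For \<open>n \<noteq> 0\<close> the antiderivative is a multiple of a sine whose
  argument at the endpoints is \<open>n * m * pi\<close> and \<open>n * (m + 1) * pi\<close>, so it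
  vanishes at both. The frequency is an integer because differences of two mode indices will be
  inserted.\<close>

lemma has_integral_cos_mode:
  fixes n m :: int and L :: real
  assumes L: "L > 0"
  shows "((\<lambda>x. cos (n * pi * (x + L) / (2 * L))) has_integral (if n = 0 then 2 * L else 0))
    {real_of_int (2 * m - 1) * L..real_of_int (2 * m + 1) * L}"
proof (cases "n = 0")
  case True
  then show ?thesis
    using L has_integral_const_real[of "1::real" "real_of_int (2 * m - 1) * L" "real_of_int (2 * m + 1) * L"]
    by (simp add: algebra_simps)
next
  case False
  define F where "F x = 2 * L / (n * pi) * sin (n * pi * (x + L) / (2 * L))" for x
  have "((\<lambda>x. cos (n * pi * (x + L) / (2 * L))) has_integral
      (F (real_of_int (2 * m + 1) * L) - F (real_of_int (2 * m - 1) * L))) {real_of_int (2 * m - 1) * L..real_of_int (2 * m + 1) * L}"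
    using L False unfolding F_def
    by (intro fundamental_theorem_of_calculus)
       (auto intro!: derivative_eq_intros simp flip: has_real_derivative_iff_has_vector_derivative)
  moreover have "F (real_of_int (2 * m + 1) * L) = 0" "F (real_of_int (2 * m - 1) * L) = 0"
  proof -
    have "n * pi * (real_of_int (2 * m + 1) * L + L) / (2 * L) = real_of_int (n * (m + 1)) * pi"
      "n * pi * (real_of_int (2 * m - 1) * L + L) / (2 * L) = real_of_int (n * m) * pi"
      using L by (simp_all add: field_simps)
    moreover have "sin (real_of_int i * pi) = 0" for i
      using sin_zero_iff_int2 by blast
    ultimately show "F (real_of_int (2 * m + 1) * L) = 0" "F (real_of_int (2 * m - 1) * L) = 0"
      unfolding F_def by (simp_all only: mult_zero_right)
  qed
  ultimately show ?thesis using False by simp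
qed

text \<open>The product-to-sum formula reduces this to the frequencies \<open>k - l\<close> and
  \<open>k + l\<close>. The second is zero only for \<open>k = l = 0\<close>, which is why the
  constant mode alone has squared norm \<open>2 * L\<close> instead of \<open>L\<close>.\<close>

lemma has_integral_cos_mult_cos:
  fixes k l :: nat and m :: int and L :: real
  assumes L: "L > 0"
  shows "((\<lambda>x. cos (k * pi * (x + L) / (2 * L)) * cos (l * pi * (x + L) / (2 * L)))
    has_integral (if k = l then if k = 0 then 2 * L else L else 0))
    {real_of_int (2 * m - 1) * L..real_of_int (2 * m + 1) * L}"
proof -
  have eq: "cos (k * pi * (x + L) / (2 * L)) * cos (l * pi * (x + L) / (2 * L)) =
     (cos (real_of_int (int k - int l) * pi * (x + L) / (2 * L)) +
      cos (real_of_int (int k + int l) * pi * (x + L) / (2 * L))) / 2" for x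
    by (simp add: cos_times_cos algebra_simps diff_divide_distrib add_divide_distrib)
  have *: "((\<lambda>x. (cos (real_of_int (int k - int l) * pi * (x + L) / (2 * L)) +
      cos (real_of_int (int k + int l) * pi * (x + L) / (2 * L))) / 2) has_integral
      ((if int k - int l = 0 then 2 * L else 0) + (if int k + int l = 0 then 2 * L else 0)) / 2)
    {real_of_int (2 * m - 1) * L..real_of_int (2 * m + 1) * L}"
    by (intro has_integral_divide has_integral_add has_integral_cos_mode L)
  show ?thesis
    unfolding eq by (rule has_integral_eq_rhs[OF *]) auto
qed

text \<open>Parseval on one cell: in the expanded square only the diagonal survives, and
  \<open>2 * L\<close> bounds the squared norm of every mode. The nonnegative integral is used so
  that countably many cells can be added up later.\<close>

lemma nn_integral_cos_poly_square_le:
  fixes b :: "nat \<Rightarrow> real" and m :: int and L :: real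
  assumes L: "L > 0"
  shows "(\<integral>\<^sup>+x. indicator {real_of_int (2 * m - 1) * L..real_of_int (2 * m + 1) * L} x *
      ennreal ((\<Sum>k<K. b k * cos (k * pi * (x + L) / (2 * L)))\<^sup>2) \<partial>lebesgue)
    \<le> ennreal (2 * L * (\<Sum>k<K. (b k)\<^sup>2))"
proof -
  let ?c = "\<lambda>k x. cos (real k * pi * (x + L) / (2 * L))"
  let ?I = "{real_of_int (2 * m - 1) * L..real_of_int (2 * m + 1) * L}"
  have eq: "(\<Sum>k<K. b k * ?c k x)\<^sup>2 = (\<Sum>k<K. \<Sum>l<K. b k * b l * (?c k x * ?c l x))" for x
    by (simp add: power2_eq_square sum_product mult_ac)
  have "((\<lambda>x. (\<Sum>k<K. b k * ?c k x)\<^sup>2) has_integral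
      (\<Sum>k<K. \<Sum>l<K. b k * b l * (if k = l then if k = 0 then 2 * L else L else 0))) ?I"
    unfolding eq
    by (intro has_integral_sum finite_lessThan has_integral_mult_right has_integral_cos_mult_cos L)
  then have "(\<integral>\<^sup>+x. indicator ?I x * ennreal ((\<Sum>k<K. b k * ?c k x)\<^sup>2) \<partial>lebesgue) =
      ennreal (\<Sum>k<K. \<Sum>l<K. b k * b l * (if k = l then if k = 0 then 2 * L else L else 0))"
    using nn_integral_has_integral_lebesgue'[of ?I "\<lambda>x. (\<Sum>k<K. b k * ?c k x)\<^sup>2"]
    by (simp only: nn_integral_completion mult.commute[of "indicator ?I _"] zero_le_power2)
  also have "\<dots> \<le> ennreal (2 * L * (\<Sum>k<K. (b k)\<^sup>2))"
    unfolding sum_distrib_left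
  proof (intro ennreal_leI sum_mono)
    fix k assume "k \<in> {..<K}"
    have "(\<Sum>l<K. b k * b l * (if k = l then if k = 0 then 2 * L else L else 0)) =
        (\<Sum>l<K. if k = l then (b l)\<^sup>2 * (if l = 0 then 2 * L else L) else 0)"
      by (intro sum.cong) (auto simp: power2_eq_square)
    also have "\<dots> = (b k)\<^sup>2 * (if k = 0 then 2 * L else L)"
      using \<open>k \<in> {..<K}\<close> by (subst sum.delta') auto
    also have "\<dots> \<le> 2 * L * (b k)\<^sup>2"
      using L by simp
    finally show "(\<Sum>l<K. b k * b l * (if k = l then if k = 0 then 2 * L else L else 0))
        \<le> 2 * L * (b k)\<^sup>2" .
  qed
  finally show ?thesis .
qed

section \<open>Weighted square integral of a cosine polynomial over the tail\<close>

text \<open>The tail is covered by the cells \<open>I m\<close> with \<open>m \<noteq> 0\<close>,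
  paired as \<open>m = j + 1\<close> and \<open>m = - j - 1\<close>. On both cells of a pair
  \<open>\<bar>x\<bar> / L\<close> is at least \<open>2 * j + 1\<close>, so the reciprocal weight is
  at most \<open>w j\<close>; \<open>q j\<close> is the resulting majorant on that pair.\<close>

lemma nn_integral_cos_poly_square_weighted_le:
  fixes b :: "nat \<Rightarrow> real" and L p :: real
  assumes L: "L > 0" and p: "p > 1"
  shows "(\<integral>\<^sup>+x. indicator {x. \<bar>x\<bar> > L} x *
      ennreal ((\<Sum>k<K. b k * cos (k * pi * (x + L) / (2 * L)))\<^sup>2 / ((\<bar>x\<bar> / L) powr p + 1)) \<partial>lebesgue)
    \<le> ennreal (2 * zeta p * L * (\<Sum>k<K. (b k)\<^sup>2))"
proof -
  define T where "T x = (\<Sum>k<K. b k * cos (k * pi * (x + L) / (2 * L)))" for x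
  define D where "D = (\<Sum>k<K. (b k)\<^sup>2)"
  define w where "w j = 1 / (real (2 * j + 1) powr p + 1)" for j
  define I where "I m = {real_of_int (2 * m - 1) * L..real_of_int (2 * m + 1) * L}" for m
  define q where "q j x = ennreal (w j) * (indicator (I (int j + 1)) x * ennreal ((T x)\<^sup>2)
      + indicator (I (- int j - 1)) x * ennreal ((T x)\<^sup>2))" for j x
  have D: "D \<ge> 0" by (simp add: D_def sum_nonneg)
  have w: "w j \<ge> 0" for j by (simp add: w_def)
  have T_meas [measurable]: "T \<in> borel_measurable borel"
    unfolding T_def by measurable
  have I_meas [measurable]: "I m \<in> sets borel" for m by (simp add: I_def)
  have q_meas: "q j \<in> borel_measurable lebesgue" for j
    unfolding q_def by (rule measurable_completion) measurable
  have int_I: "(\<integral>\<^sup>+x. indicator (I m) x * ennreal ((T x)\<^sup>2) \<partial>lebesgue) \<le> ennreal (2 * L * D)" for m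
    using nn_integral_cos_poly_square_le[OF L, where m = m and K = K and b = b] by (simp add: I_def T_def D_def)
  have pointwise: "indicator {x. \<bar>x\<bar> > L} x * ennreal ((T x)\<^sup>2 / ((\<bar>x\<bar> / L) powr p + 1)) \<le> (\<Sum>j. q j x)"
    for x
  proof (cases "\<bar>x\<bar> > L")
    case True
    \<comment> \<open>The index of the pair of cells containing \<open>x\<close>: it is chosen so
      that \<open>\<bar>x\<bar> / L\<close> lies between \<open>2 * j + 1\<close> and
      \<open>2 * j + 3\<close>. The floor is nonnegative because \<open>\<bar>x\<bar> > L\<close>,
      so \<open>nat\<close> does not truncate.\<close>
    define j where "j = nat (\<lfloor>(\<bar>x\<bar> / L - 1) / 2\<rfloor>)"
    have "0 \<le> (\<bar>x\<bar> / L - 1) / 2" using True L by (simp add: field_simps)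
    then have j: "real j \<le> (\<bar>x\<bar> / L - 1) / 2" "(\<bar>x\<bar> / L - 1) / 2 \<le> real j + 1"
      unfolding j_def by linarith+
    have lo: "real (2 * j + 1) \<le> \<bar>x\<bar> / L" and hi: "\<bar>x\<bar> / L \<le> real (2 * j + 3)"
      using j by simp_all
    from lo hi have lo': "real (2 * j + 1) * L \<le> \<bar>x\<bar>" and hi': "\<bar>x\<bar> \<le> real (2 * j + 3) * L"
      using L by (simp_all only: pos_le_divide_eq pos_divide_le_eq)
    have "x \<in> I (int j + 1) \<or> x \<in> I (- int j - 1)"
      using lo' hi' by (cases "x \<ge> 0") (auto simp: I_def algebra_simps)
    then have "ennreal (w j) * ennreal ((T x)\<^sup>2) \<le> q j x"
      unfolding q_def by (intro mult_left_mono) (auto simp: indicator_def)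
    moreover have "(T x)\<^sup>2 / ((\<bar>x\<bar> / L) powr p + 1) \<le> w j * (T x)\<^sup>2"
    proof -
      have "real (2 * j + 1) powr p \<le> (\<bar>x\<bar> / L) powr p"
        using lo p by (intro powr_mono2) auto
      then have "1 / ((\<bar>x\<bar> / L) powr p + 1) \<le> w j"
        unfolding w_def by (intro divide_left_mono mult_pos_pos add_nonneg_pos) auto
      then have "1 / ((\<bar>x\<bar> / L) powr p + 1) * (T x)\<^sup>2 \<le> w j * (T x)\<^sup>2"
        by (intro mult_right_mono) auto
      then show ?thesis by simp
    qed
    ultimately have "ennreal ((T x)\<^sup>2 / ((\<bar>x\<bar> / L) powr p + 1)) \<le> q j x"
      by (metis ennreal_leI ennreal_mult'' order_trans zero_le_power2)
    also have "\<dots> \<le> (\<Sum>j. q j x)"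
      using sum_le_suminf[of "\<lambda>j. q j x" "{j}"] by simp
    finally show ?thesis using True by simp
  qed simp
  have "(\<integral>\<^sup>+x. indicator {x. \<bar>x\<bar> > L} x * ennreal ((T x)\<^sup>2 / ((\<bar>x\<bar> / L) powr p + 1)) \<partial>lebesgue)
      \<le> (\<integral>\<^sup>+x. (\<Sum>j. q j x) \<partial>lebesgue)"
    by (intro nn_integral_mono pointwise)
  also have "\<dots> = (\<Sum>j. \<integral>\<^sup>+x. q j x \<partial>lebesgue)"
    by (intro nn_integral_suminf q_meas)
  also have "\<dots> \<le> (\<Sum>j. ennreal (2 * w j * (2 * L * D)))"
  proof (intro suminf_le summableI)
    fix j
    have ind_meas: "(\<lambda>x. indicator (I m) x * ennreal ((T x)\<^sup>2)) \<in> borel_measurable lebesgue" for m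
      by (rule measurable_completion) measurable
    have "(\<integral>\<^sup>+x. q j x \<partial>lebesgue) = ennreal (w j) *
      ((\<integral>\<^sup>+x. indicator (I (int j + 1)) x * ennreal ((T x)\<^sup>2) \<partial>lebesgue)
      + (\<integral>\<^sup>+x. indicator (I (- int j - 1)) x * ennreal ((T x)\<^sup>2) \<partial>lebesgue))"
      unfolding q_def
      by (subst nn_integral_cmult, intro borel_measurable_add ind_meas)
         (subst nn_integral_add, auto intro: ind_meas)
    also have "\<dots> \<le> ennreal (w j) * (ennreal (2 * L * D) + ennreal (2 * L * D))"
      by (intro mult_left_mono add_mono int_I) simp
    also have "\<dots> = ennreal (2 * w j * (2 * L * D))"
      using L D w[of j] by (simp flip: ennreal_plus ennreal_mult)
    finally show "(\<integral>\<^sup>+x. q j x \<partial>lebesgue) \<le> ennreal (2 * w j * (2 * L * D))" .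
  qed
  also have "\<dots> \<le> ennreal (2 * zeta p * L * D)"
    unfolding suminf_eq_SUP
  proof (rule SUP_least)
    fix n
    \<comment> \<open>The factor 2 in \<open>2 * w j\<close> counts the two cells of a pair. It is
      already part of the summand in \<open>odd_reciprocal_sum_le_zeta\<close>, so it costs no
      further constant.\<close>
    have "(\<Sum>j<n. 2 * w j) * (2 * L * D) \<le> zeta p * (2 * L * D)"
      using odd_reciprocal_sum_le_zeta[OF p, of n] L D by (intro mult_right_mono) (auto simp: w_def)
    also have "\<dots> = 2 * zeta p * L * D" by simp
    finally have "(\<Sum>j<n. 2 * w j * (2 * L * D)) \<le> 2 * zeta p * L * D"
      by (simp only: sum_distrib_right)
    then show "(\<Sum>j<n. ennreal (2 * w j * (2 * L * D))) \<le> ennreal (2 * zeta p * L * D)"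
      using L D w by (subst sum_ennreal) (auto intro!: ennreal_leI)
  qed
  finally show ?thesis by (simp add: T_def D_def)
qed

section \<open>The main estimate for B(L)\<close>

lemma cos_B_le:
  fixes f :: "real \<Rightarrow> real" and p L :: real
  assumes p: "p > 1" and L: "L > 0"
    and f: "integrable lebesgue f"
    and f2: "integrable lebesgue (\<lambda>x. \<bar>f x\<bar>\<^sup>2)"
    and fp: "integrable lebesgue (\<lambda>x. \<bar>x\<bar> powr p * \<bar>f x\<bar>\<^sup>2)"
  shows "cos_B f L \<le> ennreal (2 * zeta p *
        (L powr (-p) * (LINT x:{x. \<bar>x\<bar> > L}|lebesgue. \<bar>x\<bar> powr p * \<bar>f x\<bar>\<^sup>2)
         + (LINT x:{x. \<bar>x\<bar> > L}|lebesgue. \<bar>f x\<bar>\<^sup>2)))"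
proof -
  define E where "E = {x::real. \<bar>x\<bar> > L}"
  define c where "c k x = cos (real k * pi * (x + L) / (2 * L))" for k x
  define a where "a k = (LINT x:E|lebesgue. f x * c k x)" for k
  define W where "W x = (\<bar>x\<bar> / L) powr p + 1" for x
  define M where "M = L powr (-p) * (LINT x:E|lebesgue. \<bar>x\<bar> powr p * \<bar>f x\<bar>\<^sup>2)
         + (LINT x:E|lebesgue. \<bar>f x\<bar>\<^sup>2)"
  have E_eq: "UNIV - {-L..L} = E" by (auto simp: E_def)
  have "E \<in> sets borel"
    unfolding E_def by measurable
  then have E: "E \<in> sets lebesgue"
    by (simp add: sets_completionI_sets)
  have zeta: "zeta p > 0" using zeta_ge_1[OF p] by simp
  have W: "W x > 0" for x by (simp add: W_def add_nonneg_pos)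
  have c_meas: "c k \<in> borel_measurable lebesgue" for k
    unfolding c_def by (rule measurable_completion) measurable
  have int_fc: "set_integrable lebesgue E (\<lambda>x. f x * c k x)" for k
  proof -
    have "integrable lebesgue (\<lambda>x. f x * c k x)"
    proof (rule Bochner_Integration.integrable_bound[OF f])
      show "(\<lambda>x. f x * c k x) \<in> borel_measurable lebesgue"
        using f c_meas by (intro borel_measurable_times) auto
    qed (auto simp: abs_mult c_def intro!: mult_left_le)
    with E show ?thesis
      by (simp only: set_integrable_def integrable_mult_indicator)
  qed
  \<comment> \<open>The two summands of the weight produce exactly the two tail integrals of the
    claimed bound.\<close>
  have fW: "W x * (f x)\<^sup>2 = L powr (-p) * (\<bar>x\<bar> powr p * \<bar>f x\<bar>\<^sup>2) + \<bar>f x\<bar>\<^sup>2" for x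
    using L by (simp add: W_def powr_divide powr_minus_divide algebra_simps)
  have int1: "set_integrable lebesgue E (\<lambda>x. \<bar>x\<bar> powr p * \<bar>f x\<bar>\<^sup>2)"
    and int2: "set_integrable lebesgue E (\<lambda>x. \<bar>f x\<bar>\<^sup>2)"
    using fp f2 E by (simp_all only: set_integrable_def integrable_mult_indicator)
  have int_fW: "set_integrable lebesgue E (\<lambda>x. W x * (f x)\<^sup>2)"
    unfolding fW by (intro set_integral_add set_integrable_mult_right int1 int2)
  have M_eq: "(LINT x:E|lebesgue. W x * (f x)\<^sup>2) = M"
    unfolding fW M_def by (subst set_integral_add) (use int1 int2 in auto)
  \<comment> \<open>Finite partial sums are real numbers, so the term \<open>S / 2\<close> that
    appears on the right at the end can be absorbed on the left. The bound is uniform in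
    \<open>K\<close> and passes to the supremum.\<close>
  have bound: "(\<Sum>k<K. 1 / L * \<bar>a k\<bar>\<^sup>2) \<le> 2 * zeta p * M" for K
  proof -
    define S where "S = (\<Sum>k<K. 1 / L * \<bar>a k\<bar>\<^sup>2)"
    define T where "T x = (\<Sum>k<K. a k / L * c k x)" for x
    have S: "S \<ge> 0" using L by (simp add: S_def sum_nonneg)
    \<comment> \<open>With the coefficients \<open>a k / L\<close> of \<open>T\<close>, the
      right-hand side of the weighted estimate becomes a multiple of \<open>S\<close>
      itself.\<close>
    have SL: "L * (\<Sum>k<K. (a k / L)\<^sup>2) = S"
      using L by (simp add: S_def sum_distrib_left power2_eq_square)
    have T_meas: "T \<in> borel_measurable lebesgue"
      unfolding T_def using c_meas by simp
    have W_meas: "W \<in> borel_measurable lebesgue"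
      unfolding W_def by (rule measurable_completion) measurable
    have fT: "f x * T x = (\<Sum>k<K. a k / L * (f x * c k x))" for x
      by (simp add: T_def sum_distrib_left mult_ac)
    have int_term: "integrable lebesgue (\<lambda>x. indicator E x *\<^sub>R (a k / L * (f x * c k x)))" for k
      using set_integrable_mult_right[of "a k / L", OF int_fc[of k]] by (simp only: set_integrable_def)
    have int_fT: "set_integrable lebesgue E (\<lambda>x. f x * T x)"
      unfolding fT set_integrable_def scaleR_sum_right
      by (intro Bochner_Integration.integrable_sum int_term)
    have "(LINT x:E|lebesgue. f x * T x) = (\<Sum>k<K. LINT x:E|lebesgue. a k / L * (f x * c k x))"
      unfolding fT set_lebesgue_integral_def scaleR_sum_right
      by (intro Bochner_Integration.integral_sum int_term)
    also have "\<dots> = (\<Sum>k<K. a k / L * a k)"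
      by (simp only: set_integral_mult_right a_def)
    finally have S_sum: "(LINT x:E|lebesgue. f x * T x) = (\<Sum>k<K. a k / L * a k)" .
    have S_eq: "(LINT x:E|lebesgue. f x * T x) = S"
      by (simp add: S_sum S_def power2_eq_square)
    \<comment> \<open>This serves twice: finiteness gives integrability of
      \<open>(T x)\<^sup>2 / W x\<close>, and the value bounds its integral.\<close>
    have nn: "(\<integral>\<^sup>+x. ennreal (indicator E x *\<^sub>R ((T x)\<^sup>2 / W x)) \<partial>lebesgue) \<le> ennreal (2 * zeta p * S)"
    proof -
      have "(\<integral>\<^sup>+x. ennreal (indicator E x *\<^sub>R ((T x)\<^sup>2 / W x)) \<partial>lebesgue) =
          (\<integral>\<^sup>+x. indicator E x * ennreal ((T x)\<^sup>2 / W x) \<partial>lebesgue)"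
        by (intro nn_integral_cong) (auto simp: indicator_def)
      also have "\<dots> \<le> ennreal (2 * zeta p * S)"
        using nn_integral_cos_poly_square_weighted_le[OF L p, where K = K and b = "\<lambda>k. a k / L"]
        unfolding E_def T_def W_def c_def mult.assoc SL .
      finally show ?thesis .
    qed
    have int_TW: "set_integrable lebesgue E (\<lambda>x. (T x)\<^sup>2 / W x)"
      unfolding set_integrable_def
    proof (rule integrableI_nonneg)
      show "(\<lambda>x. indicator E x *\<^sub>R ((T x)\<^sup>2 / W x)) \<in> borel_measurable lebesgue"
        using T_meas W_meas E by measurable
      show "(\<integral>\<^sup>+x. ennreal (indicator E x *\<^sub>R ((T x)\<^sup>2 / W x)) \<partial>lebesgue) < \<infinity>"
        using nn by (rule le_less_trans) simp
    qed (use W in \<open>auto simp: less_imp_le\<close>)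
    have TW_le: "(LINT x:E|lebesgue. (T x)\<^sup>2 / W x) \<le> 2 * zeta p * S"
      unfolding set_lebesgue_integral_def using zeta S nn by (intro integral_real_bounded) auto
    \<comment> \<open>The parameter \<open>zeta p\<close> balances the inequality: since the
      integral of \<open>(T x)\<^sup>2 / W x\<close> is at most \<open>2 * zeta p * S\<close>, the
      last term contributes at most \<open>S / 2\<close>.\<close>
    have young: "f x * T x \<le> zeta p * (W x * (f x)\<^sup>2) + 1 / (4 * zeta p) * ((T x)\<^sup>2 / W x)" for x
    proof -
      have "0 \<le> (2 * zeta p * W x * f x - T x)\<^sup>2 / (4 * zeta p * W x)"
        using zeta W[of x] by simp
      also have "\<dots> = zeta p * (W x * (f x)\<^sup>2) + 1 / (4 * zeta p) * ((T x)\<^sup>2 / W x) - f x * T x"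
        using zeta W[of x] by (simp add: field_simps power2_eq_square)
      finally show ?thesis by simp
    qed
    have "S \<le> (LINT x:E|lebesgue. zeta p * (W x * (f x)\<^sup>2) + 1 / (4 * zeta p) * ((T x)\<^sup>2 / W x))"
      unfolding S_eq[symmetric]
      by (intro set_integral_mono int_fT set_integral_add set_integrable_mult_right int_fW int_TW young)
    also have "\<dots> = zeta p * M + 1 / (4 * zeta p) * (LINT x:E|lebesgue. (T x)\<^sup>2 / W x)"
      by (subst set_integral_add)
         (auto intro!: set_integrable_mult_right int_fW int_TW simp only: M_eq set_integral_mult_right)
    also have "\<dots> \<le> zeta p * M + 1 / (4 * zeta p) * (2 * zeta p * S)"
      using zeta TW_le by (intro add_left_mono mult_left_mono) auto
    also have "\<dots> = zeta p * M + S / 2"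
      using zeta by simp
    finally show ?thesis by (simp add: S_def)
  qed
  have "cos_B f L = (\<Sum>k. ennreal (1 / L * \<bar>a k\<bar>\<^sup>2))"
    by (simp add: cos_B_def E_eq a_def c_def)
  also have "\<dots> \<le> ennreal (2 * zeta p * M)"
    unfolding suminf_eq_SUP
    using L bound by (intro SUP_least) (auto simp: sum_ennreal simp del: power2_abs intro!: ennreal_leI)
  finally show ?thesis by (simp add: M_def E_def)
qed

section \<open>Decay of tail integrals and the asymptotic statements\<close>

text \<open>Dominated convergence with majorant \<open>\<bar>h x\<bar>\<close>: each fixed
  \<open>x\<close> lies outside the tail as soon as \<open>L \<ge> \<bar>x\<bar>\<close>. Applied to
  the weighted square of \<open>f\<close>, this supplies the little-o remainder.\<close>

lemma tendsto_tail_integral_0: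
  fixes h :: "real \<Rightarrow> real"
  assumes h: "integrable lebesgue h"
  shows "((\<lambda>L. LINT x:{x. \<bar>x\<bar> > L}|lebesgue. h x) \<longlongrightarrow> 0) at_top"
proof -
  have "((\<lambda>L. LINT x|lebesgue. indicator {x. \<bar>x\<bar> > L} x *\<^sub>R h x) \<longlongrightarrow> (LINT (x::real)|lebesgue. 0::real)) at_top"
  proof (rule integral_dominated_convergence_at_top[where w = "\<lambda>x. \<bar>h x\<bar>"])
    have E: "{x. \<bar>x\<bar> > L} \<in> sets lebesgue" for L :: real
      by (intro sets_completionI_sets) simp
    show "(\<lambda>x. indicator {x. \<bar>x\<bar> > L} x *\<^sub>R h x) \<in> borel_measurable lebesgue" for L :: real
      using h E[of L] by (intro borel_measurable_scaleR borel_measurable_indicator) auto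
    show "AE x in lebesgue. ((\<lambda>L. indicator {x. \<bar>x\<bar> > L} x *\<^sub>R h x) \<longlongrightarrow> 0) at_top"
    proof (intro AE_I2 tendsto_eventually)
      fix x :: real
      show "\<forall>\<^sub>F L in at_top. indicator {x. \<bar>x\<bar> > L} x *\<^sub>R h x = 0"
        using eventually_ge_at_top[of "\<bar>x\<bar>"] by eventually_elim simp
    qed
  qed (use h in \<open>auto simp: indicator_def\<close>)
  then show ?thesis by (simp add: set_lebesgue_integral_def)
qed

text \<open>On the tail \<open>(\<bar>x\<bar> / L) powr p\<close> is at least 1. This merges the two
  terms of the sharper bound into one with constant 4, and it controls the remainder.\<close>

lemma set_integral_abs_power2_le:
  fixes f :: "real \<Rightarrow> real" and p L :: real
  assumes p: "p \<ge> 0" and L: "L > 0"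
    and f2: "integrable lebesgue (\<lambda>x. \<bar>f x\<bar>\<^sup>2)"
    and fp: "integrable lebesgue (\<lambda>x. \<bar>x\<bar> powr p * \<bar>f x\<bar>\<^sup>2)"
  shows "(LINT x:{x. \<bar>x\<bar> > L}|lebesgue. \<bar>f x\<bar>\<^sup>2)
    \<le> L powr (-p) * (LINT x:{x. \<bar>x\<bar> > L}|lebesgue. \<bar>x\<bar> powr p * \<bar>f x\<bar>\<^sup>2)"
proof -
  have E: "{x. \<bar>x\<bar> > L} \<in> sets lebesgue"
    by (intro sets_completionI_sets) simp
  have "(LINT x:{x. \<bar>x\<bar> > L}|lebesgue. \<bar>f x\<bar>\<^sup>2)
    \<le> (LINT x:{x. \<bar>x\<bar> > L}|lebesgue. L powr (-p) * (\<bar>x\<bar> powr p * \<bar>f x\<bar>\<^sup>2))"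
  proof (rule set_integral_mono)
    show "set_integrable lebesgue {x. \<bar>x\<bar> > L} (\<lambda>x. \<bar>f x\<bar>\<^sup>2)"
      using E f2 by (simp only: set_integrable_def integrable_mult_indicator)
    show "set_integrable lebesgue {x. \<bar>x\<bar> > L} (\<lambda>x. L powr (-p) * (\<bar>x\<bar> powr p * \<bar>f x\<bar>\<^sup>2))"
      using E fp by (intro set_integrable_mult_right) (simp only: set_integrable_def integrable_mult_indicator)
    fix x :: real assume "x \<in> {x. \<bar>x\<bar> > L}"
    then have "L powr p \<le> \<bar>x\<bar> powr p"
      using L p by (intro powr_mono2) auto
    then have "1 \<le> L powr (-p) * \<bar>x\<bar> powr p"
      using L by (simp add: powr_minus_divide)
    then have "1 * \<bar>f x\<bar>\<^sup>2 \<le> (L powr (-p) * \<bar>x\<bar> powr p) * \<bar>f x\<bar>\<^sup>2"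
      by (intro mult_right_mono) auto
    then show "\<bar>f x\<bar>\<^sup>2 \<le> L powr (-p) * (\<bar>x\<bar> powr p * \<bar>f x\<bar>\<^sup>2)"
      by (simp add: mult.assoc)
  qed
  then show ?thesis by simp
qed

theorem proposition1:
  fixes f :: "real \<Rightarrow> real" and p :: real
  assumes "p > 1"
    and "integrable lebesgue f"
    and "square_integrable f"
    and "square_integrable (\<lambda>x. \<bar>x\<bar> powr (p / 2) * f x)"
  shows "COS_admissible f \<and>
    (\<forall>L>0. cos_B f L \<le> ennreal (2 * zeta p *
        (L powr (-p) * (LINT x:{x. \<bar>x\<bar> > L}|lebesgue. \<bar>x\<bar> powr p * \<bar>f x\<bar>\<^sup>2)
         + (LINT x:{x. \<bar>x\<bar> > L}|lebesgue. \<bar>f x\<bar>\<^sup>2)))) \<and>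
    (\<forall>L>0. cos_B f L \<le> ennreal (4 * zeta p * L powr (-p) *
        (LINT x:{x. \<bar>x\<bar> > L}|lebesgue. \<bar>x\<bar> powr p * \<bar>f x\<bar>\<^sup>2))) \<and>
    (\<forall>L>0. cos_B f L \<le> ennreal (4 * zeta p * L powr (-p) *
        (LINT x|lebesgue. \<bar>x\<bar> powr p * \<bar>f x\<bar>\<^sup>2))) \<and>
    (\<lambda>L. enn2real (cos_B f L)) \<in> O[at_top](\<lambda>L. L powr (-p)) \<and>
    (\<exists>r :: real \<Rightarrow> real. r \<in> o[at_top](\<lambda>L. L powr (-p)) \<and>
      (\<forall>\<^sub>F L in at_top. enn2real (cos_B f L) \<le>
         2 * zeta p * L powr (-p) * (LINT x|lebesgue. \<bar>x\<bar> powr p * \<bar>f x\<bar>\<^sup>2) + r L))"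
proof -
  define A where "A L = (LINT x:{x. \<bar>x\<bar> > L}|lebesgue. \<bar>x\<bar> powr p * \<bar>f x\<bar>\<^sup>2)" for L
  define C where "C L = (LINT x:{x. \<bar>x\<bar> > L}|lebesgue. \<bar>f x\<bar>\<^sup>2)" for L
  define J where "J = (LINT x|lebesgue. \<bar>x\<bar> powr p * \<bar>f x\<bar>\<^sup>2)"
  have f2: "integrable lebesgue (\<lambda>x. \<bar>f x\<bar>\<^sup>2)"
    using assms(3) by (simp add: square_integrable_def)
  have "\<bar>\<bar>x\<bar> powr (p / 2) * f x\<bar>\<^sup>2 = \<bar>x\<bar> powr p * \<bar>f x\<bar>\<^sup>2" for x
    by (simp add: power_mult_distrib power2_eq_square flip: powr_add)
  then have fp: "integrable lebesgue (\<lambda>x. \<bar>x\<bar> powr p * \<bar>f x\<bar>\<^sup>2)"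
    using assms(4) unfolding square_integrable_def by presburger
  have zeta: "zeta p \<ge> 1" by (rule zeta_ge_1[OF assms(1)])
  have first: "cos_B f L \<le> ennreal (2 * zeta p * (L powr (-p) * A L + C L))" if "L > 0" for L
    using cos_B_le[OF assms(1) that assms(2) f2 fp] by (simp add: A_def C_def)
  have C_nonneg: "C L \<ge> 0" for L
    by (simp add: C_def set_lebesgue_integral_def)
  have A_le_J: "A L \<le> J" for L
    unfolding A_def J_def set_lebesgue_integral_def
  proof (rule integral_mono)
    have "{x. \<bar>x\<bar> > L} \<in> sets lebesgue"
      by (intro sets_completionI_sets) simp
    then show "integrable lebesgue (\<lambda>x. indicator {x. \<bar>x\<bar> > L} x *\<^sub>R (\<bar>x\<bar> powr p * \<bar>f x\<bar>\<^sup>2))"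
      using fp by (rule integrable_mult_indicator)
  qed (use fp in \<open>auto simp: indicator_def\<close>)
  have C_le: "C L \<le> L powr (-p) * A L" if "L > 0" for L
    using set_integral_abs_power2_le[of p L f] assms(1) that f2 fp by (simp add: A_def C_def)
  have second: "cos_B f L \<le> ennreal (4 * zeta p * L powr (-p) * A L)" if "L > 0" for L
  proof -
    have "2 * zeta p * (L powr (-p) * A L + C L) \<le> 2 * zeta p * (L powr (-p) * A L + L powr (-p) * A L)"
      using C_le[OF that] zeta by (intro mult_left_mono add_left_mono) auto
    then show ?thesis
      by (intro order_trans[OF first[OF that]] ennreal_leI) (simp add: mult_ac)
  qed
  have third: "cos_B f L \<le> ennreal (4 * zeta p * L powr (-p) * J)" if "L > 0" for L
    using A_le_J[of L] zeta
    by (intro order_trans[OF second[OF that]] ennreal_leI mult_left_mono) auto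
  have J: "J \<ge> 0" by (simp add: J_def)
  have "((\<lambda>L. ennreal (4 * zeta p * L powr (-p) * J)) \<longlongrightarrow> ennreal (4 * zeta p * 0 * J)) at_top"
    using assms(1) by (intro tendsto_ennrealI tendsto_intros tendsto_neg_powr filterlim_ident) auto
  then have "(cos_B f \<longlongrightarrow> 0) at_top"
    by (intro tendsto_sandwich[of "\<lambda>_. 0" "cos_B f" at_top, OF _ _ tendsto_const])
       (auto intro!: eventually_mono[OF eventually_gt_at_top[of 0]] third)
  then have adm: "COS_admissible f"
    using assms(2) by (simp add: COS_admissible_def)
  \<comment> \<open>Although \<open>enn2real\<close> sends \<infinity> to 0, nothing is hidden here:
    \<open>third\<close> shows that \<open>cos_B f L\<close> is finite for every
    \<open>L > 0\<close>.\<close>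
  have bigo: "(\<lambda>L. enn2real (cos_B f L)) \<in> O[at_top](\<lambda>L. L powr (-p))"
  proof (rule bigoI)
    show "\<forall>\<^sub>F L in at_top. norm (enn2real (cos_B f L)) \<le> (4 * zeta p * J) * norm (L powr (-p))"
      using eventually_gt_at_top[of "0::real"]
    proof eventually_elim
      case (elim L)
      then show ?case
        using enn2real_leI[OF _ third[OF elim]] zeta J by (simp add: mult_ac)
    qed
  qed
  \<comment> \<open>The unweighted tail is the remainder \<open>r\<close>. By \<open>C_le\<close>
    its quotient by \<open>L powr (-p)\<close> is at most \<open>2 * zeta p * A L\<close>, a tail
    integral of an integrable function, which tends to 0.\<close>
  have "(\<lambda>L. 2 * zeta p * C L) \<in> o[at_top](\<lambda>L. L powr (-p))"
  proof (rule smalloI_tendsto)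
    show "((\<lambda>L. 2 * zeta p * C L / L powr (-p)) \<longlongrightarrow> 0) at_top"
    proof (rule tendsto_sandwich[OF _ _ tendsto_const])
      show "((\<lambda>L. 2 * zeta p * A L) \<longlongrightarrow> 0) at_top"
        unfolding A_def using tendsto_tail_integral_0[OF fp] by (intro tendsto_mult_right_zero)
      show "\<forall>\<^sub>F L in at_top. 0 \<le> 2 * zeta p * C L / L powr (-p)"
        using zeta C_nonneg by (intro always_eventually allI divide_nonneg_nonneg mult_nonneg_nonneg) auto
      show "\<forall>\<^sub>F L in at_top. 2 * zeta p * C L / L powr (-p) \<le> 2 * zeta p * A L"
        using eventually_gt_at_top[of "0::real"]
      proof eventually_elim
        case (elim L)
        have "2 * zeta p * C L \<le> 2 * zeta p * (L powr (-p) * A L)"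
          using C_le[OF elim] zeta by (intro mult_left_mono) auto
        then show ?case
          using elim by (subst pos_divide_le_eq) (simp_all add: mult_ac)
      qed
    qed
    show "\<forall>\<^sub>F L in at_top. L powr (-p) \<noteq> 0"
      using eventually_gt_at_top[of "0::real"] by eventually_elim simp
  qed
  moreover have "\<forall>\<^sub>F L in at_top. enn2real (cos_B f L) \<le> 2 * zeta p * L powr (-p) * J + 2 * zeta p * C L"
    using eventually_gt_at_top[of "0::real"]
  proof eventually_elim
    case (elim L)
    have "2 * zeta p * (L powr (-p) * A L + C L) \<le> 2 * zeta p * (L powr (-p) * J + C L)"
      using A_le_J[of L] zeta by (intro mult_left_mono add_right_mono) auto
    then have "cos_B f L \<le> ennreal (2 * zeta p * L powr (-p) * J + 2 * zeta p * C L)"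
      by (intro order_trans[OF first[OF elim]] ennreal_leI) (simp add: algebra_simps)
    then show ?case
      using zeta J C_nonneg[of L] by (intro enn2real_leI) auto
  qed
  ultimately have "\<exists>r. r \<in> o[at_top](\<lambda>L. L powr (-p)) \<and>
      (\<forall>\<^sub>F L in at_top. enn2real (cos_B f L) \<le> 2 * zeta p * L powr (-p) * J + r L)"
    by (intro exI[of _ "\<lambda>L. 2 * zeta p * C L"] conjI)
  then show ?thesis
    unfolding A_def[symmetric] C_def[symmetric] J_def[symmetric]
    using adm first second third bigo by (intro conjI allI impI)
qed

end
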